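(* Let $q\ge1$, let $A=(a_1,\ldots,a_q)$, $B=(b_1,\ldots,b_q)$ be real vectors with $B\prec^W A$, and let $\sigma>0$. Then for all $x>-1$ the inequality $$ \frac{1}{\left(1+x\prod_{i=1}^{q}(a_i/b_i)\right)^{\sigma}}\le{}_{q+1}F_q(\sigma,A;B;-x) $$ holds true, with equality only for $x=0$.
   Context: $B\prec^W A$ means: $0<a_1\le\cdots\le a_q$, $0<b_1\le\cdots\le b_q$, and $\sum_{i=1}^{k}a_i\le\sum_{i=1}^{k}b_i$ for $k=1,\ldots,q$. The generalized hypergeometric function is ${}_{q+1}F_q(\sigma,A;B;z)=\sum_{n=0}^{\infty}\frac{(\sigma)_n(a_1)_n\cdots(a_q)_n}{(b_1)_n\cdots(b_q)_n\,n!}z^n$ for $|z|<1$, extended by analytic continuation to $\mathbb{C}\setminus[1,\infty)$; $(a)_0=1$, $(a)_n=a(a+1)\cdots(a+n-1)$.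
   Formalization: The claim that equality holds only for x=0 is stated for A≠B only: when A=B, which satisfies B≺^W A, both sides equal (1+x)^{-σ} for every x>-1, so the claim fails there. The inequality itself is stated for all A, B, including A=B. *)

theory Defs
  imports "HOL-Complex_Analysis.Complex_Analysis"
begin

text \<open>
  The power series of the generalized hypergeometric function is
  \<^term>\<open>eval_fps (fps_hypergeo as bs 1)\<close>; the function itself is the continuation
  of this series from the unit disc to the complex plane cut along \<open>[1, \<infinity>)\<close>.
  The continuation is unique on the cut plane (see the lemma below), so the choice made by
  \<open>SOME\<close> is immaterial there; on the cut the value is unspecified.
\<close>

definition is_hypergeo :: "complex list \<Rightarrow> complex list \<Rightarrow> (complex \<Rightarrow> complex) \<Rightarrow> bool" where
  "is_hypergeo as bs f \<longleftrightarrow>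
     f holomorphic_on - (complex_of_real ` {1..}) \<and>
     (\<forall>z. norm z < 1 \<longrightarrow> f z = eval_fps (fps_hypergeo as bs 1) z)"

definition hypergeo :: "complex list \<Rightarrow> complex list \<Rightarrow> complex \<Rightarrow> complex" where
  "hypergeo as bs = (SOME f. is_hypergeo as bs f)"

lemma hypergeo_unique:
  assumes f: "is_hypergeo as bs f" and z: "z \<notin> complex_of_real ` {1..}"
  shows "hypergeo as bs z = f z"
proof (rule analytic_continuation_open[where s = "ball 0 1" and s' = "- (complex_of_real ` {1..})"
      and f = "hypergeo as bs" and g = f])
  have g: "is_hypergeo as bs (hypergeo as bs)"
    unfolding hypergeo_def using f by (rule someI[of "is_hypergeo as bs"])
  have "closed (complex_of_real ` {1..})"
    by (intro closed_injective_linear_image) (auto simp: linear_of_real inj_def)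
  then show "open (- (complex_of_real ` {1..}))" by auto
  show "connected (- (complex_of_real ` {1..}))"
    by (intro starlike_imp_connected starlike_slotted_complex_plane_right)
  show "hypergeo as bs holomorphic_on - (complex_of_real ` {1..})"
    using g by (simp add: is_hypergeo_def)
  show "f holomorphic_on - (complex_of_real ` {1..})"
    using f by (simp add: is_hypergeo_def)
  show "hypergeo as bs w = f w" if "w \<in> ball 0 1" for w
    using f g that by (simp add: is_hypergeo_def)
qed (use z in auto)

text \<open>
  \<open>weakly_majorized B A\<close> stands for \<open>B \<prec>\<^sup>W A\<close>. Positivity and the increasing order of
  both vectors are part of the relation.
\<close>

definition weakly_majorized :: "real list \<Rightarrow> real list \<Rightarrow> bool" where
  "weakly_majorized B A \<longleftrightarrow>
     length A = length B \<and>
     sorted A \<and> (\<forall>a\<in>set A. 0 < a) \<and>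
     sorted B \<and> (\<forall>b\<in>set B. 0 < b) \<and>
     (\<forall>k\<in>{1..length A}. sum_list (take k A) \<le> sum_list (take k B))"

end

theory Submission
  imports Defs "HOL-Probability.Probability" "HOL-Real_Asymp.Real_Asymp"
begin

text \<open>
  Put \<open>m n = (a\<^sub>1)\<^sub>n \<dots> (a\<^sub>q)\<^sub>n / ((b\<^sub>1)\<^sub>n \<dots> (b\<^sub>q)\<^sub>n)\<close>. The differences of \<open>ln (m n) - ln (m (n + 1))\<close>
  are sums over \<open>i\<close> of \<open>g (a\<^sub>i) - g (b\<^sub>i)\<close> with \<open>g\<close> decreasing and convex, hence nonnegative by
  weak majorization. Therefore \<open>m\<close> is completely monotone, and so it is the moment sequence
  of a random variable \<open>X\<close> with values in \<open>[0, 1]\<close>. Expanding in powers of \<open>z\<close> shows that the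
  hypergeometric function is the expectation of \<open>(1 - z X)\<close> to the power \<open>- \<sigma>\<close>, which is
  holomorphic in the cut plane. The inequality is then Jensen's inequality, since the expectation
  of \<open>X\<close> is \<open>m 1\<close>. If \<open>A \<noteq> B\<close>, the differences are strictly positive; this gives
  \<open>m 2 > (m 1)\<^sup>2\<close>, so \<open>X\<close> is not almost surely constant and Jensen's inequality is strict.
\<close>

section \<open>Iterated differences and weak majorization\<close>

text \<open>This is (-1)^k times the k-th forward difference, so complete monotonicity of
  \<open>f\<close> means \<open>0 \<le> bdiff k f n\<close> for all \<open>k\<close> and
  \<open>n\<close>. Taking the first difference of the sequence before recursing suits inductions
  that replace \<open>f\<close> by that difference; \<open>bdiff_Suc_eq\<close> gives the outer
  form.\<close>

primrec bdiff :: "nat \<Rightarrow> (nat \<Rightarrow> real) \<Rightarrow> nat \<Rightarrow> real" where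
  "bdiff 0 f = f"
| "bdiff (Suc k) f = bdiff k (\<lambda>n. f n - f (Suc n))"

lemma bdiff_Suc_eq: "bdiff (Suc k) f n = bdiff k f n - bdiff k f (Suc n)"
proof (induction k arbitrary: f)
  case (Suc k)
  show ?case using Suc.IH[of "\<lambda>n. f n - f (Suc n)"] by (simp only: bdiff.simps)
qed simp

lemma bdiff_add: "bdiff k (\<lambda>n. f n + g n) n = bdiff k f n + bdiff k g n"
proof (induction k arbitrary: n)
  case (Suc k)
  then show ?case by (simp only: bdiff_Suc_eq)
qed simp

lemma bdiff_shift: "bdiff k (\<lambda>n. f (Suc n)) n = bdiff k f (Suc n)"
  by (induction k arbitrary: n) (simp_all only: bdiff_Suc_eq bdiff.simps(1))

lemma bdiff_cmult: "bdiff k (\<lambda>n. c * f n) n = c * bdiff k f n"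
  by (induction k arbitrary: n) (simp_all only: bdiff_Suc_eq bdiff.simps(1) right_diff_distrib)

lemma bdiff_diff: "bdiff k (\<lambda>n. f n - g n) n = bdiff k f n - bdiff k g n"
  using bdiff_add[of k f "\<lambda>n. - 1 * g n"] bdiff_cmult[of k "-1" g] by simp

lemma bdiff_sum: "bdiff k (\<lambda>n. \<Sum>i\<in>I. f i n) n = (\<Sum>i\<in>I. bdiff k (f i) n)"
  by (induction k arbitrary: n) (simp_all only: bdiff_Suc_eq bdiff.simps(1) sum_subtractf)

lemma bdiff_tendsto:
  assumes "\<And>n. (\<lambda>M. f M n) \<longlonglongrightarrow> g n"
  shows "(\<lambda>M. bdiff k (f M) n) \<longlonglongrightarrow> bdiff k g n"
  by (induction k arbitrary: n) (use assms in \<open>auto simp only: bdiff_Suc_eq bdiff.simps(1) intro!: tendsto_diff\<close>)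

lemma has_real_derivative_bdiff:
  assumes "\<And>m. (h m has_real_derivative h' m) (at y)"
  shows "((\<lambda>y. bdiff k (\<lambda>m. h m y) n) has_real_derivative bdiff k h' n) (at y)"
  by (induction k arbitrary: n)
    (use assms in \<open>auto simp only: bdiff_Suc_eq bdiff.simps(1) intro!: DERIV_diff\<close>)

text \<open>Discrete analogue of the k-th derivative of 1/y. In the induction step the two
  Pochhammer symbols share the factor \<open>p\<close>, and their remaining factors \<open>u\<close>
  and \<open>v\<close> differ by k + 1, which turns k! into (k + 1)!.\<close>

lemma bdiff_inverse:
  assumes "y > 0"
  shows "bdiff k (\<lambda>m. 1 / (y + real m)) n = fact k / pochhammer (y + real n) (Suc k)"
proof (induction k arbitrary: n)
  case (Suc k)
  define p where "p = pochhammer (y + real n + 1) k"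
  have p: "p > 0" unfolding p_def using assms by (intro pochhammer_pos) auto
  have 1: "pochhammer (y + real n) (Suc k) = (y + real n) * p"
    by (simp add: pochhammer_rec p_def)
  have 2: "pochhammer (y + real (Suc n)) (Suc k) = p * (y + real n + 1 + real k)"
    by (simp add: pochhammer_rec' p_def add_ac)
  have 3: "pochhammer (y + real n) (Suc (Suc k)) = (y + real n) * p * (y + real n + 1 + real k)"
    by (subst pochhammer_rec') (simp only: 1, simp add: add_ac)
  define u v where "u = y + real n" and "v = u + 1 + real k"
  have uv: "u > 0" "v > 0" "v - u = 1 + real k" using assms by (auto simp: u_def v_def)
  have "fact k / (u * p) - fact k / (p * v) = (v - u) * fact k / (u * p * v)"
    using p uv(1,2) by (simp add: divide_simps) (simp add: algebra_simps)
  then show ?case unfolding bdiff_Suc_eq Suc 1 2 3 using uv(3)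
    by (simp add: u_def v_def)
qed (use assms in simp)

section \<open>Sequences that are completely monotone on a finite range\<close>

text \<open>\<open>bdiff k f n\<close> involves only the values of \<open>f\<close> from
  \<open>n\<close> to \<open>n + k\<close>, so the condition concerns \<open>f\<close> on 0, ..., N
  alone. The finite range matters because the approximants 1 + ln f / M become nonnegative only on
  finitely many indices at a time.\<close>

definition cm_upto :: "nat \<Rightarrow> (nat \<Rightarrow> real) \<Rightarrow> bool" where
  "cm_upto N f \<longleftrightarrow> (\<forall>k n. k + n \<le> N \<longrightarrow> 0 \<le> bdiff k f n)"

lemma cm_upto_Suc:
  "cm_upto (Suc N) f \<longleftrightarrow> (\<forall>n\<le>Suc N. 0 \<le> f n) \<and> cm_upto N (\<lambda>n. f n - f (Suc n))"
  (is "?L \<longleftrightarrow> ?R")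
proof
  assume L: ?L
  show ?R unfolding cm_upto_def
  proof (intro conjI allI impI)
    show "0 \<le> f n" if "n \<le> Suc N" for n
      using L[unfolded cm_upto_def, rule_format, of 0 n] that by simp
    show "0 \<le> bdiff k (\<lambda>n. f n - f (Suc n)) n" if "k + n \<le> N" for k n
      using L[unfolded cm_upto_def, rule_format, of "Suc k" n] that by simp
  qed
next
  assume R: ?R
  show ?L unfolding cm_upto_def
  proof (intro allI impI)
    fix k n assume "k + n \<le> Suc N"
    then show "0 \<le> bdiff k f n"
      using R by (cases k) (auto simp: cm_upto_def)
  qed
qed

lemma cm_upto_add: "cm_upto N f \<Longrightarrow> cm_upto N g \<Longrightarrow> cm_upto N (\<lambda>n. f n + g n)"
  by (simp add: cm_upto_def bdiff_add)

text \<open>Discrete Leibniz rule: the first difference of the product is a sum of two products,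
  each of a first difference and a possibly shifted factor. All of these are completely monotone up
  to \<open>N\<close>, so the induction hypothesis applies.\<close>

lemma cm_upto_mult:
  assumes "cm_upto N f" "cm_upto N g"
  shows "cm_upto N (\<lambda>n. f n * g n)"
  using assms
proof (induction N arbitrary: f g)
  case 0
  then show ?case by (simp add: cm_upto_def)
next
  case (Suc N)
  have f: "cm_upto N (\<lambda>n. f n - f (Suc n))" and g: "cm_upto N (\<lambda>n. g n - g (Suc n))"
    and pos: "\<forall>n\<le>Suc N. 0 \<le> f n" "\<forall>n\<le>Suc N. 0 \<le> g n"
    using Suc.prems by (auto simp: cm_upto_Suc)
  have "cm_upto N g" "cm_upto N (\<lambda>n. f (Suc n))"
    using Suc.prems by (auto simp: cm_upto_def bdiff_shift)
  then have "cm_upto N (\<lambda>n. (f n - f (Suc n)) * g n + f (Suc n) * (g n - g (Suc n)))"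
    using f g by (intro cm_upto_add Suc.IH)
  also have "(\<lambda>n. (f n - f (Suc n)) * g n + f (Suc n) * (g n - g (Suc n))) =
      (\<lambda>n. f n * g n - f (Suc n) * g (Suc n))"
    by (simp add: algebra_simps)
  finally show ?case using pos by (simp add: cm_upto_Suc)
qed

lemma cm_upto_power: "cm_upto N f \<Longrightarrow> cm_upto N (\<lambda>n. f n ^ M)"
proof (induction M)
  case 0
  have "cm_upto N (\<lambda>n. 1)"
  proof -
    \<comment> \<open>For positive \<open>k\<close> the first difference is the zero sequence, and
      \<open>bdiff_cmult\<close> with factor 0 shows that its differences vanish.\<close>
    have "bdiff k (\<lambda>n. 1) n = (if k = 0 then 1 else 0)" for k n
      by (cases k) (use bdiff_cmult[of _ 0 "\<lambda>n. 0"] in auto)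
    then show ?thesis by (simp add: cm_upto_def)
  qed
  then show ?case by simp
next
  case (Suc M)
  then show ?case by (simp add: cm_upto_mult)
qed

text \<open>
  The sequence \<open>f\<close> is the limit of \<open>(1 + ln f / M) ^ M\<close>. On a finite range of indices
  the base of this power is completely monotone as soon as \<open>M\<close> is so large that it is nonnegative.
\<close>
lemma bdiff_nonneg_if_log:
  assumes pos: "\<And>n. 0 < f n"
    and log: "\<And>k n. 0 \<le> bdiff k (\<lambda>n. ln (f n) - ln (f (Suc n))) n"
  shows "0 \<le> bdiff k f n"
proof -
  define N where "N = k + n"
  define h where "h M n = 1 + ln (f n) / real M" for M n
  have lim: "(\<lambda>M. bdiff k (\<lambda>n. h M n ^ M) n) \<longlonglongrightarrow> bdiff k f n"
  proof (rule bdiff_tendsto)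
    fix n
    show "(\<lambda>M. h M n ^ M) \<longlonglongrightarrow> f n"
      using tendsto_exp_limit_sequentially[of "ln (f n)"] pos[of n] by (simp add: h_def)
  qed
  \<comment> \<open>Each \<open>h M n\<close> tends to 1, and only the indices up to
    \<open>Suc N\<close> matter, so one threshold for \<open>M\<close> serves them all.\<close>
  have "\<forall>\<^sub>F M in sequentially. \<forall>n\<in>{..Suc N}. 0 \<le> h M n"
  proof (subst eventually_ball_finite_distrib, simp, rule ballI)
    fix n
    have "(\<lambda>M. h M n) \<longlonglongrightarrow> 1 + 0"
      unfolding h_def by (intro tendsto_add tendsto_const tendsto_divide_0[OF tendsto_const]
        filterlim_at_top_imp_at_infinity filterlim_real_sequentially)
    then have "\<forall>\<^sub>F M in sequentially. 0 < h M n"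
      by (rule order_tendstoD) simp
    then show "\<forall>\<^sub>F M in sequentially. 0 \<le> h M n"
      by eventually_elim simp
  qed
  then have "\<forall>\<^sub>F M in sequentially. 0 \<le> bdiff k (\<lambda>n. h M n ^ M) n"
  proof eventually_elim
    case (elim M)
    have eq: "h M n - h M (Suc n) = (1 / real M) * (ln (f n) - ln (f (Suc n)))" for n
      by (simp add: h_def diff_divide_distrib)
    have "cm_upto N (\<lambda>n. h M n - h M (Suc n))"
      unfolding eq by (auto simp: cm_upto_def bdiff_cmult simp del: times_divide_eq_left
        intro!: mult_nonneg_nonneg log)
    then have "cm_upto (Suc N) (h M)"
      using elim by (auto simp: cm_upto_Suc)
    then have "cm_upto (Suc N) (\<lambda>n. h M n ^ M)"
      by (rule cm_upto_power)
    then show ?case by (simp add: cm_upto_def N_def)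
  qed
  then show ?thesis
    by (rule tendsto_lowerbound[OF lim]) simp
qed

section \<open>Convexity and weak majorization\<close>

text \<open>Abel summation as an induction: since the partial sums of \<open>d\<close> are
  nonnegative and \<open>w\<close> decreases, the weighted sum up to \<open>n\<close> is at least
  \<open>w n\<close> times the plain sum.\<close>

lemma sum_mult_nonneg_if_partial_sums:
  fixes w d :: "nat \<Rightarrow> real"
  assumes "\<And>i j. i \<le> j \<Longrightarrow> j < q \<Longrightarrow> w j \<le> w i" and "\<And>i. i < q \<Longrightarrow> 0 \<le> w i"
    and part: "\<And>k. k \<le> q \<Longrightarrow> 0 \<le> (\<Sum>i<k. d i)"
  shows "0 \<le> (\<Sum>i<q. w i * d i)"
proof -
  have *: "w n * (\<Sum>i<Suc n. d i) \<le> (\<Sum>i<Suc n. w i * d i)" if "n < q" for n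
    using that
  proof (induction n)
    case (Suc n)
    have "w (Suc n) * (\<Sum>i<Suc n. d i) \<le> w n * (\<Sum>i<Suc n. d i)"
      using Suc.prems assms(1)[of n "Suc n"] part[of "Suc n"] by (intro mult_right_mono) auto
    also have "\<dots> \<le> (\<Sum>i<Suc n. w i * d i)" using Suc by simp
    finally show ?case by (simp add: distrib_left)
  qed simp
  show ?thesis
  proof (cases q)
    case (Suc n)
    have "0 \<le> w n * (\<Sum>i<Suc n. d i)" using part[of q] assms(2)[of n] Suc by simp
    also have "\<dots> \<le> (\<Sum>i<Suc n. w i * d i)" using * Suc by blast
    finally show ?thesis using Suc by simp
  qed simp
qed

text \<open>By the mean value theorem the secant slope is \<open>g' z\<close> for some
  \<open>z\<close> strictly between \<open>a\<close> and \<open>b\<close>, and \<open>g'\<close> is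
  strictly increasing.\<close>

lemma tangent_below_strict:
  fixes g g' :: "real \<Rightarrow> real"
  assumes der: "\<And>y. 0 < y \<Longrightarrow> (g has_real_derivative g' y) (at y)"
    and mono: "\<And>y z. 0 < y \<Longrightarrow> y < z \<Longrightarrow> g' y < g' z"
    and "0 < a" "0 < b" "a \<noteq> b"
  shows "g b + g' b * (a - b) < g a"
proof (cases "a < b")
  case True
  obtain z where z: "a < z" "z < b" "g b - g a = (b - a) * g' z"
    using MVT2[OF True, of g g'] der \<open>0 < a\<close> by (metis order_less_le_trans)
  have "(b - a) * g' z < (b - a) * g' b" using z True mono[of z b] \<open>0 < a\<close> by simp
  then show ?thesis using z(3) by (simp add: algebra_simps)
next
  case False
  then have ba: "b < a" using assms by simp
  obtain z where z: "b < z" "z < a" "g a - g b = (a - b) * g' z"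
    using MVT2[OF ba, of g g'] der \<open>0 < b\<close> by (metis order_less_le_trans)
  have "(a - b) * g' b < (a - b) * g' z" using z ba mono[of b z] \<open>0 < b\<close> by simp
  then show ?thesis using z(3) by (simp add: algebra_simps)
qed

text \<open>
  The inequality of Tomic and Weyl: sum the tangent inequalities at the points \<open>b i\<close>; the linear
  terms add up to a nonnegative number by summation by parts.
\<close>
lemma weak_majorization_sum_less:
  fixes g g' :: "real \<Rightarrow> real" and a b :: "nat \<Rightarrow> real"
  assumes der: "\<And>y. 0 < y \<Longrightarrow> (g has_real_derivative g' y) (at y)"
    and mono: "\<And>y z. 0 < y \<Longrightarrow> y < z \<Longrightarrow> g' y < g' z"
    and neg: "\<And>y. 0 < y \<Longrightarrow> g' y \<le> 0"
    and a: "\<And>i. i < q \<Longrightarrow> 0 < a i" and b: "\<And>i. i < q \<Longrightarrow> 0 < b i"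
    and b_mono: "\<And>i j. i \<le> j \<Longrightarrow> j < q \<Longrightarrow> b i \<le> b j"
    and part: "\<And>k. k \<le> q \<Longrightarrow> (\<Sum>i<k. a i) \<le> (\<Sum>i<k. b i)"
    and ne: "\<exists>i<q. a i \<noteq> b i"
  shows "(\<Sum>i<q. g (b i)) < (\<Sum>i<q. g (a i))"
proof -
  \<comment> \<open>The weights \<open>- g' (b i)\<close> are nonnegative and decrease with
    \<open>i\<close>, and the partial sums of \<open>b i - a i\<close> are nonnegative by
    majorization.\<close>
  have "0 \<le> (\<Sum>i<q. - g' (b i) * (b i - a i))"
  proof (rule sum_mult_nonneg_if_partial_sums)
    show "- g' (b j) \<le> - g' (b i)" if "i \<le> j" "j < q" for i j
      using b_mono[OF that] mono[of "b i" "b j"] b[of i] that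
      by (cases "b i = b j") auto
  qed (use neg b part in \<open>auto simp: sum_subtractf\<close>)
  also have "\<dots> = (\<Sum>i<q. g' (b i) * (a i - b i))"
    by (intro sum.cong) (auto simp: algebra_simps)
  finally have "(\<Sum>i<q. g (b i)) \<le> (\<Sum>i<q. g (b i) + g' (b i) * (a i - b i))"
    by (simp add: sum.distrib)
  \<comment> \<open>Strictness comes from an index with \<open>a i \<noteq> b i\<close>, where the
    tangent inequality is strict.\<close>
  also have "\<dots> < (\<Sum>i<q. g (a i))"
  proof (rule sum_strict_mono_ex1)
    have less: "g (b i) + g' (b i) * (a i - b i) < g (a i)" if "i < q" "a i \<noteq> b i" for i
      using tangent_below_strict[of g g' "a i" "b i", OF der mono] a b that by blast
    show "\<forall>i\<in>{..<q}. g (b i) + g' (b i) * (a i - b i) \<le> g (a i)"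
    proof
      fix i assume "i \<in> {..<q}"
      then show "g (b i) + g' (b i) * (a i - b i) \<le> g (a i)"
        using less[of i] by (cases "a i = b i") auto
    qed
    show "\<exists>i\<in>{..<q}. g (b i) + g' (b i) * (a i - b i) < g (a i)"
      using less ne by blast
  qed simp
  finally show ?thesis .
qed

section \<open>The Hausdorff moment problem\<close>

text \<open>Binomial expansion of (S + (1 - S))^K = 1 with the shift S, where 1 - S is the
  difference operator. For \<open>n = 0\<close> it gives the total mass of the Bernstein
  weights.\<close>

lemma sum_binomial_bdiff:
  "(\<Sum>j\<le>K. real (K choose j) * bdiff (K - j) f (n + j)) = f n"
proof (induction K arbitrary: n)
  case (Suc K)
  have "(\<Sum>j\<le>Suc K. real (Suc K choose j) * bdiff (Suc K - j) f (n + j)) =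
      bdiff (Suc K) f n + (\<Sum>j\<le>K. real (Suc K choose Suc j) * bdiff (K - j) f (Suc (n + j)))"
    by (subst sum.atMost_Suc_shift) simp
  \<comment> \<open>Pascal's rule.\<close>
  also have "\<dots> = bdiff (Suc K) f n + (\<Sum>j\<le>K. real (K choose Suc j) * bdiff (K - j) f (Suc (n + j)))
      + (\<Sum>j\<le>K. real (K choose j) * bdiff (K - j) f (Suc n + j))"
    by (simp add: distrib_right sum.distrib)
  also have "(\<Sum>j\<le>K. real (K choose j) * bdiff (K - j) f (Suc n + j)) = f (Suc n)"
    by (rule Suc.IH)
  also have "bdiff (Suc K) f n + (\<Sum>j\<le>K. real (K choose Suc j) * bdiff (K - j) f (Suc (n + j))) =
      (\<Sum>j\<le>Suc K. real (K choose j) * bdiff (Suc K - j) f (n + j))"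
    by (subst sum.atMost_Suc_shift) simp
  \<comment> \<open>The summand for \<open>j = Suc K\<close> drops out, because K choose K + 1 is
    0.\<close>
  also have "\<dots> = (\<Sum>j\<le>K. real (K choose j) * bdiff (Suc (K - j)) f (n + j))"
    by (simp add: Suc_diff_le del: bdiff.simps)
  also have "\<dots> = (\<Sum>j\<le>K. real (K choose j) * bdiff (K - j) f (n + j)) -
      (\<Sum>j\<le>K. real (K choose j) * bdiff (K - j) f (Suc n + j))"
    by (simp add: bdiff_Suc_eq right_diff_distrib sum_subtractf del: bdiff.simps)
  also have "\<dots> = f n - f (Suc n)"
    by (simp only: Suc.IH)
  finally show ?case by simp
qed simp

text \<open>Numerator and denominator are falling factorials, that is n! times a binomial
  coefficient. For \<open>k < n\<close> both sides are 0.\<close>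

lemma prod_diff_quotient_eq_binomial:
  assumes "n \<le> N"
  shows "(\<Prod>i<n. (real k - real i) / (real N - real i)) = real (k choose n) / real (N choose n)"
  using assms
  by (simp add: binomial_gbinomial gbinomial_prod_rev prod_dividef atLeast0LessThan)

text \<open>Factorial moments of the Bernstein weights are exact for every \<open>N\<close>: the
  identity \<open>choose_mult\<close> moves the binomial factor out of the sum and leaves
  \<open>sum_binomial_bdiff\<close> with \<open>K = N - n\<close>.\<close>

lemma sum_binomial_bdiff_moment:
  assumes "n \<le> N"
  shows "(\<Sum>k\<le>N. (\<Prod>i<n. (real k - real i) / (real N - real i)) *
           (real (N choose k) * bdiff (N - k) f k)) = f n"
proof -
  have "(\<Sum>k\<le>N. (\<Prod>i<n. (real k - real i) / (real N - real i)) *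
           (real (N choose k) * bdiff (N - k) f k)) =
      (\<Sum>k\<in>{n..N}. real ((N - n) choose (k - n)) * bdiff (N - k) f k)"
  proof (rule sum.mono_neutral_cong_right)
    fix k assume k: "k \<in> {n..N}"
    have "real (N choose k) * real (k choose n) = real (N choose n) * real ((N - n) choose (k - n))"
      using choose_mult[of n k N] k by (metis atLeastAtMost_iff of_nat_mult)
    moreover have "real (N choose n) \<noteq> 0" using assms by simp
    ultimately show "(\<Prod>i<n. (real k - real i) / (real N - real i)) *
        (real (N choose k) * bdiff (N - k) f k) = real ((N - n) choose (k - n)) * bdiff (N - k) f k"
      unfolding prod_diff_quotient_eq_binomial[OF assms] by (simp add: field_simps)
  qed (use prod_diff_quotient_eq_binomial[OF assms] in auto)
  also have "\<dots> = (\<Sum>j\<le>N - n. real ((N - n) choose j) * bdiff (N - n - j) f (n + j))"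
    by (rule sum.reindex_bij_witness[of _ "\<lambda>j. n + j" "\<lambda>k. k - n"]) (use assms in auto)
  also have "\<dots> = f n" by (rule sum_binomial_bdiff)
  finally show ?thesis .
qed

text \<open>All factors have modulus at most 1, so the products differ by at most the sum of the
  factorwise differences. The bound does not depend on \<open>k\<close> and tends to 0 as
  \<open>N\<close> grows, so ordinary moments may replace factorial ones in the limit.\<close>

lemma power_approx_prod_diff_quotient:
  assumes "2 * n < N" "k \<le> N"
  shows "\<bar>(\<Prod>i<n. (real k - real i) / (real N - real i)) - (real k / real N) ^ n\<bar>
    \<le> (\<Sum>i<n. real i / (real N - real i))"
proof -
  have "norm ((\<Prod>i<n. (real k - real i) / (real N - real i)) - (\<Prod>i<n. real k / real N))
      \<le> (\<Sum>i<n. norm ((real k - real i) / (real N - real i) - real k / real N))"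
  proof (rule norm_prod_diff)
    fix i assume i: "i \<in> {..<n}"
    \<comment> \<open>If \<open>k < i\<close>, then \<open>i - k \<le> i \<le> N - i\<close>, which
      uses \<open>2 * n < N\<close>.\<close>
    then have "0 < real N - real i" "\<bar>real k - real i\<bar> \<le> real N - real i" using assms by auto
    then show "norm ((real k - real i) / (real N - real i)) \<le> 1" by simp
    show "norm (real k / real N) \<le> 1" using assms by simp
  qed
  also have "\<dots> \<le> (\<Sum>i<n. real i / (real N - real i))"
  proof (rule sum_mono)
    fix i assume i: "i \<in> {..<n}"
    have N: "0 < real N - real i" "0 < real N" using assms i by auto
    have "(real k - real i) / (real N - real i) - real k / real N =
        - (real i / (real N - real i) * ((real N - real k) / real N))"
      using N by (simp add: divide_simps) (simp add: algebra_simps)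
    moreover have "\<bar>(real N - real k) / real N\<bar> \<le> 1" using assms N by simp
    then have "\<bar>real i / (real N - real i)\<bar> * \<bar>(real N - real k) / real N\<bar>
        \<le> \<bar>real i / (real N - real i)\<bar> * 1"
      by (rule mult_left_mono) simp
    ultimately show "norm ((real k - real i) / (real N - real i) - real k / real N)
        \<le> real i / (real N - real i)"
      using N by (simp add: abs_mult)
  qed
  finally show ?thesis by simp
qed

text \<open>The discrete laws \<open>\<mu> N\<close> live on [0, 1], hence are tight, and a
  subsequence converges weakly to some \<open>M\<close>. Their factorial moments are exact, so their
  ordinary moments tend to \<open>m n\<close>, and weak convergence passes this to
  \<open>M\<close>.\<close>

theorem hausdorff_moment:
  fixes m :: "nat \<Rightarrow> real"
  assumes m0: "m 0 = 1" and cm: "\<And>k n. 0 \<le> bdiff k m n"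
  obtains M :: "real measure" and X :: "real \<Rightarrow> real"
  where "prob_space M" "X \<in> borel_measurable M" "\<And>s. X s \<in> {0..1}"
    "\<And>n. integral\<^sup>L M (\<lambda>s. X s ^ n) = m n"
proof -
  \<comment> \<open>The Bernstein weights: mass \<open>w N k\<close> at \<open>k / N\<close> approximates the law to be constructed.\<close>
  define w where "w N k = real (N choose k) * bdiff (N - k) m k" for N k
  have w_nonneg: "0 \<le> w N k" for N k by (simp add: w_def cm)
  have w_sum: "(\<Sum>k\<le>N. w N k) = 1" for N
    using sum_binomial_bdiff[of N m 0] m0 by (simp add: w_def)
  have w_0: "w N k = 0" if "N < k" for N k using that by (simp add: w_def)
  have w_nn: "(\<integral>\<^sup>+k. ennreal (w N k) \<partial>count_space UNIV) = 1" for N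
  proof -
    have "(\<integral>\<^sup>+k. ennreal (w N k) \<partial>count_space UNIV) = (\<Sum>k\<le>N. ennreal (w N k))"
      by (rule nn_integral_count_space') (auto simp: w_0)
    also have "\<dots> = 1" by (simp add: w_nonneg w_sum sum_ennreal)
    finally show ?thesis .
  qed
  define p where "p N = embed_pmf (w N)" for N
  have pmf_p: "pmf (p N) k = w N k" for N k
    unfolding p_def by (rule pmf_embed_pmf) (auto simp: w_nonneg w_nn)
  \<comment> \<open>Using \<open>Suc N\<close> keeps the denominator of the atoms nonzero.\<close>
  define \<mu> where "\<mu> N = distr (measure_pmf (p (Suc N))) borel (\<lambda>k. real k / real (Suc N))" for N
  have rd: "real_distribution (\<mu> N)" for N
    unfolding \<mu>_def real_distribution_def real_distribution_axioms_def
    by (auto intro!: prob_space.prob_space_distr prob_space_measure_pmf)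
  have int_\<mu>: "integral\<^sup>L (\<mu> N) f = (\<Sum>k\<le>Suc N. f (real k / real (Suc N)) * w (Suc N) k)"
    if [measurable]: "f \<in> borel_measurable borel" for f :: "real \<Rightarrow> real" and N
  proof -
    have "integral\<^sup>L (\<mu> N) f = (\<integral>k. f (real k / real (Suc N)) \<partial>measure_pmf (p (Suc N)))"
      unfolding \<mu>_def by (rule integral_distr) auto
    also have "\<dots> = (\<Sum>k\<le>Suc N. f (real k / real (Suc N)) * pmf (p (Suc N)) k)"
      by (rule integral_measure_pmf_real) (auto simp: set_pmf_iff pmf_p intro: leI dest: w_0)
    finally show ?thesis by (simp add: pmf_p)
  qed
  \<comment> \<open>Tightness is stated with intervals open on the left, and 0 may carry mass; hence
    the left end -1.\<close>
  have "measure (\<mu> N) {-1<..1} = 1" for N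
  proof -
    interpret real_distribution "\<mu> N" by (rule rd)
    have "measure (\<mu> N) {-1<..1} = (\<integral>s. indicator {-1<..1} s \<partial>\<mu> N)" by simp
    also have "\<dots> = (\<Sum>k\<le>Suc N. w (Suc N) k)"
      by (subst int_\<mu>) (auto intro!: sum.cong simp: indicator_def less_le_trans[OF _ divide_nonneg_nonneg])
    finally show ?thesis by (simp only: w_sum)
  qed
  then have "\<exists>a b. a < b \<and> (\<forall>N. 1 - \<epsilon> < measure (\<mu> N) {a<..b})" if "0 < \<epsilon>" for \<epsilon>
    by (intro exI[of _ "- 1 :: real"] exI[of _ "1 :: real"]) (simp add: that)
  then have "tight \<mu>" unfolding tight_def using rd by blast
  from tight_imp_convergent_subsubsequence[OF this strict_mono_id]
  obtain r M where r: "strict_mono (r :: nat \<Rightarrow> nat)" and M: "real_distribution M"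
    and wc: "weak_conv_m (\<mu> \<circ> r) M" by auto
  interpret M: real_distribution M by (rule M)
  \<comment> \<open>Clamping to [0, 1] fixes the atoms of every \<open>\<mu> N\<close> and makes the
    powers of \<open>X\<close> bounded and continuous on the whole line, so the support of
    \<open>M\<close> need not be determined.\<close>
  define X where "X s = max 0 (min 1 s)" for s :: real
  have X01: "X s \<in> {0..1}" for s by (simp add: X_def)
  have X_cont: "continuous_on UNIV (\<lambda>s. X s ^ n)" for n unfolding X_def by (intro continuous_intros)
  then have X_meas: "(\<lambda>s. X s ^ n) \<in> borel_measurable borel" for n
    by (rule borel_measurable_continuous_onI)
  have moment: "(\<lambda>N. integral\<^sup>L (\<mu> N) (\<lambda>s. X s ^ n)) \<longlonglongrightarrow> m n" for n
  proof -
    define e where "e N = (\<Sum>i<n. real i / (real (Suc N) - real i))" for N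
    have e0: "e \<longlonglongrightarrow> 0"
      unfolding e_def by (rule tendsto_null_sum) real_asymp
    have "\<forall>\<^sub>F N in sequentially. norm (integral\<^sup>L (\<mu> N) (\<lambda>s. X s ^ n) - m n) \<le> e N"
      using eventually_gt_at_top[of "2 * n"]
    proof eventually_elim
      case (elim N)
      let ?P = "\<lambda>k. \<Prod>i<n. (real k - real i) / (real (Suc N) - real i)"
      have "integral\<^sup>L (\<mu> N) (\<lambda>s. X s ^ n) = (\<Sum>k\<le>Suc N. (real k / real (Suc N)) ^ n * w (Suc N) k)"
        by (subst int_\<mu>[OF X_meas]) (auto intro!: sum.cong simp: X_def min_def max_def)
      moreover have "m n = (\<Sum>k\<le>Suc N. ?P k * w (Suc N) k)"
        using sum_binomial_bdiff_moment[of n "Suc N" m] elim by (simp only: w_def)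
      ultimately have "norm (integral\<^sup>L (\<mu> N) (\<lambda>s. X s ^ n) - m n) =
          norm (\<Sum>k\<le>Suc N. ((real k / real (Suc N)) ^ n - ?P k) * w (Suc N) k)"
        by (simp only: left_diff_distrib sum_subtractf)
      also have "\<dots> \<le> (\<Sum>k\<le>Suc N. e N * w (Suc N) k)"
      proof (rule sum_norm_le)
        fix k assume "k \<in> {..Suc N}"
        then have "\<bar>(real k / real (Suc N)) ^ n - ?P k\<bar> \<le> e N"
          unfolding e_def using power_approx_prod_diff_quotient[of n "Suc N" k] elim
          by (simp add: abs_minus_commute)
        then have "\<bar>(real k / real (Suc N)) ^ n - ?P k\<bar> * w (Suc N) k \<le> e N * w (Suc N) k"
          by (rule mult_right_mono[OF _ w_nonneg])
        then show "norm (((real k / real (Suc N)) ^ n - ?P k) * w (Suc N) k) \<le> e N * w (Suc N) k"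
          by (simp only: real_norm_def abs_mult abs_of_nonneg[OF w_nonneg])
      qed
      also have "\<dots> = e N" by (simp only: sum_distrib_left[symmetric] w_sum mult_1_right)
      finally show ?case .
    qed
    then have "(\<lambda>N. integral\<^sup>L (\<mu> N) (\<lambda>s. X s ^ n) - m n) \<longlonglongrightarrow> 0"
      by (rule Lim_null_comparison[OF _ e0])
    then show ?thesis by (simp add: LIM_zero_iff)
  qed
  show thesis
  proof
    show "prob_space M" by (rule M.prob_space_axioms)
    show "X \<in> borel_measurable M" using X_meas[of 1] by simp
    show "X s \<in> {0..1}" for s by (rule X01)
    show "integral\<^sup>L M (\<lambda>s. X s ^ n) = m n" for n
    proof (rule LIMSEQ_unique)
      show "(\<lambda>N. integral\<^sup>L ((\<mu> \<circ> r) N) (\<lambda>s. X s ^ n)) \<longlonglongrightarrow> integral\<^sup>L M (\<lambda>s. X s ^ n)"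
      proof (rule weak_conv_imp_integral_bdd_continuous_conv[OF _ M wc])
        show "real_distribution ((\<mu> \<circ> r) N)" for N using rd by simp
        show "isCont (\<lambda>s. X s ^ n) s" for s
          using X_cont by (simp add: continuous_on_eq_continuous_at)
        show "norm (X s ^ n) \<le> 1" for s
          using X01[of s] by (simp add: power_le_one)
      qed
      show "(\<lambda>N. integral\<^sup>L ((\<mu> \<circ> r) N) (\<lambda>s. X s ^ n)) \<longlonglongrightarrow> m n"
        using LIMSEQ_subseq_LIMSEQ[OF moment r] by (simp add: o_def)
    qed
  qed
qed

section \<open>Integral representation of the hypergeometric function\<close>

lemma (in prob_space) integrable_continuous_on_compact:
  fixes f :: "real \<Rightarrow> 'b::{banach, second_countable_topology}"
  assumes [measurable]: "X \<in> borel_measurable M" and K: "compact K" "\<And>\<omega>. X \<omega> \<in> K"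
    and f: "continuous_on K f"
  shows "integrable M (\<lambda>\<omega>. f (X \<omega>))"
proof -
  have "X \<in> measurable M (restrict_space borel K)"
    using K by (intro measurable_restrict_space2) auto
  then have "(\<lambda>\<omega>. f (X \<omega>)) \<in> borel_measurable M"
    by (rule measurable_compose[OF _ borel_measurable_continuous_on_restrict[OF f]])
  moreover obtain B where "\<And>t. t \<in> K \<Longrightarrow> norm (f t) \<le> B"
    using compact_imp_bounded[OF compact_continuous_image[OF f K(1)]] by (auto simp: bounded_iff)
  ultimately show ?thesis
    using K(2) by (intro integrable_const_bound[of _ B]) auto
qed

text \<open>Differentiation under the expectation. On a closed disc around \<open>z0\<close> times
  \<open>K\<close> the derivative \<open>H'\<close> is bounded by compactness; the bound carries
  over to the difference quotients and dominates them.\<close>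

lemma (in prob_space) holomorphic_on_expectation:
  fixes H H' :: "complex \<Rightarrow> real \<Rightarrow> complex"
  assumes X: "X \<in> borel_measurable M" and K: "compact K" "\<And>\<omega>. X \<omega> \<in> K" and U: "open U"
    and H: "\<And>z. z \<in> U \<Longrightarrow> continuous_on K (H z)"
    and H': "continuous_on (U \<times> K) (\<lambda>(z, t). H' z t)"
    and der: "\<And>z t. z \<in> U \<Longrightarrow> t \<in> K \<Longrightarrow> ((\<lambda>z. H z t) has_field_derivative H' z t) (at z)"
  shows "(\<lambda>z. expectation (\<lambda>\<omega>. H z (X \<omega>))) holomorphic_on U"
proof -
  have "((\<lambda>z. expectation (\<lambda>\<omega>. H z (X \<omega>))) has_field_derivative
      expectation (\<lambda>\<omega>. H' z0 (X \<omega>))) (at z0)" if z0: "z0 \<in> U" for z0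
  proof -
    obtain r where r: "r > 0" "cball z0 r \<subseteq> U"
      using U z0 open_contains_cball by blast
    have "compact (cball z0 r \<times> K)" using K by (simp add: compact_Times)
    moreover have "continuous_on (cball z0 r \<times> K) (\<lambda>(z, t). H' z t)"
      by (rule continuous_on_subset[OF H']) (use r in auto)
    ultimately obtain B where B: "\<And>z t. z \<in> cball z0 r \<Longrightarrow> t \<in> K \<Longrightarrow> norm (H' z t) \<le> B"
      using compact_imp_bounded[OF compact_continuous_image] by (fastforce simp: bounded_iff)
    have int: "integrable M (\<lambda>\<omega>. H z (X \<omega>))" if "z \<in> U" for z
      by (rule integrable_continuous_on_compact[OF X K H[OF that]])
    have "continuous_on K (H' z0)"
      using continuous_on_compose2[OF H' continuous_on_Pair[OF continuous_on_const[of K z0] continuous_on_id]]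
        z0 by auto
    then have int': "integrable M (\<lambda>\<omega>. H' z0 (X \<omega>))"
      by (rule integrable_continuous_on_compact[OF X K])
    let ?Q = "\<lambda>z t. (H z t - H z0 t) / (z - z0)"
    have Q_le: "norm (?Q z t) \<le> B" if "z \<in> ball z0 r - {z0}" "t \<in> K" for z t
    proof -
      have "norm (H z t - H z0 t) \<le> B * norm (z - z0)"
      proof (rule field_differentiable_bound[of "cball z0 r" "\<lambda>z. H z t" "\<lambda>z. H' z t"])
        show "((\<lambda>z. H z t) has_field_derivative H' z t) (at z within cball z0 r)"
          if "z \<in> cball z0 r" for z
          using der[OF subsetD[OF r(2) that] \<open>t \<in> K\<close>] by (rule has_field_derivative_at_within)
      qed (use B r that in auto)
      then show ?thesis using that by (simp add: norm_divide divide_simps)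
    qed
    have "((\<lambda>z. expectation (\<lambda>\<omega>. ?Q z (X \<omega>))) \<longlongrightarrow> expectation (\<lambda>\<omega>. H' z0 (X \<omega>)))
        (at z0 within ball z0 r)"
      \<comment> \<open>Dominated convergence is applied along sequences tending to
        \<open>z0\<close>.\<close>
      unfolding tendsto_at_iff_sequentially
    proof (intro allI impI)
      fix S :: "nat \<Rightarrow> complex"
      assume S: "\<forall>i. S i \<in> ball z0 r - {z0}" "S \<longlonglongrightarrow> z0"
      have SU: "S i \<in> U" for i using S(1) subsetD[OF r(2), of "S i"] by (simp add: less_imp_le)
      have "(\<lambda>i. expectation (\<lambda>\<omega>. ?Q (S i) (X \<omega>))) \<longlonglongrightarrow> expectation (\<lambda>\<omega>. H' z0 (X \<omega>))"
      proof (rule integral_dominated_convergence[where w = "\<lambda>_. B"])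
        show "(\<lambda>\<omega>. H' z0 (X \<omega>)) \<in> borel_measurable M"
          using int' by simp
        show "(\<lambda>\<omega>. ?Q (S i) (X \<omega>)) \<in> borel_measurable M" for i
          using int[OF SU[of i]] int[OF z0]
          by (intro borel_measurable_divide borel_measurable_diff) auto
        show "AE \<omega> in M. norm (?Q (S i) (X \<omega>)) \<le> B" for i
          using Q_le[of "S i"] S(1) K(2) by auto
        show "AE \<omega> in M. (\<lambda>i. ?Q (S i) (X \<omega>)) \<longlonglongrightarrow> H' z0 (X \<omega>)"
        proof (rule AE_I2)
          fix \<omega>
          have "((\<lambda>z. ?Q z (X \<omega>)) \<longlongrightarrow> H' z0 (X \<omega>)) (at z0)"
            using der[OF z0 K(2)] by (simp add: has_field_derivative_iff)
          then show "(\<lambda>i. ?Q (S i) (X \<omega>)) \<longlonglongrightarrow> H' z0 (X \<omega>)"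
            by (rule filterlim_compose) (use S in \<open>auto simp: filterlim_at\<close>)
        qed
      qed simp
      then show "((\<lambda>z. expectation (\<lambda>\<omega>. ?Q z (X \<omega>))) \<circ> S) \<longlonglongrightarrow> expectation (\<lambda>\<omega>. H' z0 (X \<omega>))"
        by (simp add: o_def)
    qed
    then have "((\<lambda>z. expectation (\<lambda>\<omega>. ?Q z (X \<omega>))) \<longlongrightarrow> expectation (\<lambda>\<omega>. H' z0 (X \<omega>))) (at z0)"
      using r by (simp add: at_within_open[of z0 "ball z0 r"])
    moreover have "\<forall>\<^sub>F z in at z0. expectation (\<lambda>\<omega>. ?Q z (X \<omega>)) =
        (expectation (\<lambda>\<omega>. H z (X \<omega>)) - expectation (\<lambda>\<omega>. H z0 (X \<omega>))) / (z - z0)"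
      using eventually_at_in_open'[OF U z0]
      by eventually_elim (simp add: int z0)
    ultimately show ?thesis
      unfolding has_field_derivative_iff by (rule Lim_transform_eventually)
  qed
  then show ?thesis
    using holomorphic_on_open[OF U] by blast
qed

text \<open>Keeps the base of the power off the branch cut of \<open>powr\<close>: otherwise
  \<open>z * t\<close> would be real and at least 1, and dividing by \<open>t \<le> 1\<close> would
  put \<open>z\<close> on the cut.\<close>

lemma one_minus_mult_notin_nonpos_Reals:
  assumes "z \<notin> complex_of_real ` {1..}" "t \<in> {0..1}"
  shows "1 - z * complex_of_real t \<notin> \<real>\<^sub>\<le>\<^sub>0"
proof
  assume "1 - z * complex_of_real t \<in> \<real>\<^sub>\<le>\<^sub>0"
  then obtain u where u: "1 - z * complex_of_real t = complex_of_real u" "u \<le> 0"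
    by (auto elim: nonpos_Reals_cases)
  then have "z * complex_of_real t = complex_of_real (1 - u)" by (simp add: algebra_simps)
  moreover have "t \<noteq> 0" using u by auto
  ultimately have "z = complex_of_real ((1 - u) / t)" by (simp add: field_simps)
  moreover have "1 \<le> (1 - u) / t" using assms \<open>t \<noteq> 0\<close> u by (simp add: field_simps)
  ultimately show False using assms(1) by blast
qed

lemma closed_of_real_atLeast: "closed (complex_of_real ` {a..})"
  by (intro closed_injective_linear_image) (auto simp: linear_of_real inj_def)

text \<open>The coefficients of \<open>fps_hypergeo\<close> are given by left folds.\<close>

lemma foldl_mult_eq_prod_list:
  "foldl (\<lambda>r a. r * f a) (c :: 'a :: comm_monoid_mult) xs = c * prod_list (map f xs)"
  by (induction xs arbitrary: c) (auto simp: mult_ac)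

text \<open>Inside the unit disc the binomial series of the integrand is integrated term by term,
  and the moments supply the Pochhammer quotients. Holomorphy on the cut plane makes the expectation
  the continuation, whose existence is thereby proved.\<close>

lemma (in prob_space) is_hypergeo_expectation:
  fixes X :: "'a \<Rightarrow> real" and \<sigma> :: real
  assumes X: "X \<in> borel_measurable M" and X01: "\<And>\<omega>. X \<omega> \<in> {0..1}"
    and mom: "\<And>n. expectation (\<lambda>\<omega>. X \<omega> ^ n) =
      prod_list (map (\<lambda>a. pochhammer a n) A) / prod_list (map (\<lambda>b. pochhammer b n) B)"
  shows "is_hypergeo (map complex_of_real (\<sigma> # A)) (map complex_of_real B)
    (\<lambda>z. expectation (\<lambda>\<omega>. (1 - z * complex_of_real (X \<omega>)) powr (- complex_of_real \<sigma>)))"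
  unfolding is_hypergeo_def
proof (intro conjI allI impI)
  define U where "U = - (complex_of_real ` {1..})"
  have notin: "1 - z * complex_of_real t \<in> - \<real>\<^sub>\<le>\<^sub>0" if "z \<in> U" "t \<in> {0..1}" for z t
    using one_minus_mult_notin_nonpos_Reals that by (auto simp: U_def simp del: complex_nonpos_Reals_iff)
  have cont_powr: "continuous_on (- \<real>\<^sub>\<le>\<^sub>0) (\<lambda>w :: complex. w powr s)" for s
    by (intro holomorphic_on_imp_continuous_on holomorphic_intros) auto
  show "(\<lambda>z. expectation (\<lambda>\<omega>. (1 - z * complex_of_real (X \<omega>)) powr (- complex_of_real \<sigma>)))
      holomorphic_on - complex_of_real ` {1..}"
    unfolding U_def[symmetric]
  proof (rule holomorphic_on_expectation[OF X, where K = "{0..1}"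
        and H' = "\<lambda>z t. complex_of_real \<sigma> * complex_of_real t *
          (1 - z * complex_of_real t) powr (- complex_of_real \<sigma> - 1)"])
    show "open U" unfolding U_def by (simp add: closed_of_real_atLeast open_Compl)
    show "continuous_on {0..1} (\<lambda>t. (1 - z * complex_of_real t) powr - complex_of_real \<sigma>)"
      if "z \<in> U" for z
      by (rule continuous_on_compose2[OF cont_powr])
        (use that notin in \<open>auto intro!: continuous_intros simp del: complex_nonpos_Reals_iff\<close>)
    show "continuous_on (U \<times> {0..1}) (\<lambda>(z, t). complex_of_real \<sigma> * complex_of_real t *
        (1 - z * complex_of_real t) powr (- complex_of_real \<sigma> - 1))"
      unfolding case_prod_unfold
      by (intro continuous_intros continuous_on_compose2[OF cont_powr])
        (use notin in \<open>auto simp del: complex_nonpos_Reals_iff\<close>)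
    show "((\<lambda>z. (1 - z * complex_of_real t) powr - complex_of_real \<sigma>) has_field_derivative
        complex_of_real \<sigma> * complex_of_real t *
          (1 - z * complex_of_real t) powr (- complex_of_real \<sigma> - 1)) (at z)"
      if "z \<in> U" "t \<in> {0..1}" for z t
      using notin[OF that] by (auto intro!: derivative_eq_intros simp del: complex_nonpos_Reals_iff)
  qed (use X01 in auto)
next
  fix z :: complex assume z: "norm z < 1"
  define c where "c n = (- complex_of_real \<sigma> gchoose n) * (- z) ^ n" for n
  \<comment> \<open>A point of modulus strictly between that of \<open>z\<close> and 1: convergence
    of the binomial series at \<open>y\<close> gives absolute convergence at \<open>- z\<close>,
    hence a summable majorant.\<close>
  define y where "y = complex_of_real ((norm z + 1) / 2)"
  have y: "norm y < 1" "norm (- z) < norm y" using z by (auto simp: y_def)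
  have c_summable: "summable (\<lambda>n. norm (c n))" unfolding c_def
    by (rule powser_insidea[OF sums_summable[OF gen_binomial_complex[OF y(1)]] y(2)])
  define f where "f n \<omega> = c n * complex_of_real (X \<omega> ^ n)" for n \<omega>
  have f_sums: "(\<lambda>n. f n \<omega>) sums (1 - z * complex_of_real (X \<omega>)) powr (- complex_of_real \<sigma>)" for \<omega>
  proof -
    have "norm z * \<bar>X \<omega>\<bar> \<le> norm z * 1" using X01[of \<omega>] by (intro mult_left_mono) auto
    then have "norm (- z * complex_of_real (X \<omega>)) < 1" using z by (simp add: norm_mult)
    note gen_binomial_complex[OF this, of "- complex_of_real \<sigma>"]
    moreover have "f n \<omega> = (- complex_of_real \<sigma> gchoose n) * (- z * complex_of_real (X \<omega>)) ^ n" for n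
      unfolding f_def c_def power_mult_distrib by simp
    ultimately show ?thesis by simp
  qed
  have X_int: "integrable M (\<lambda>\<omega>. X \<omega> ^ n)" for n
    by (rule integrable_continuous_on_compact[OF X, of "{0..1}"]) (use X01 in \<open>auto intro!: continuous_intros\<close>)
  have f_int: "integrable M (f n)" for n
    unfolding f_def using X_int[of n] by (intro integrable_mult_right integrable_of_real)
  have f_le: "norm (f n \<omega>) \<le> norm (c n)" for n \<omega>
    using X01[of \<omega>] unfolding f_def norm_mult
    by (intro mult_left_le) (auto simp: norm_power power_le_one)
  have "(\<lambda>n. expectation (f n)) sums expectation (\<lambda>\<omega>. \<Sum>n. f n \<omega>)"
  proof (rule sums_integral[OF f_int])
    show "AE \<omega> in M. summable (\<lambda>n. norm (f n \<omega>))"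
      by (intro AE_I2 summable_comparison_test'[OF c_summable, of 0]) (simp add: f_le)
    have "norm (expectation (\<lambda>\<omega>. norm (f n \<omega>))) \<le> norm (c n)" for n
      using integral_le_const[of "\<lambda>\<omega>. norm (f n \<omega>)" "norm (c n)"] f_int[of n] f_le
      by (auto intro!: integral_nonneg)
    then show "summable (\<lambda>n. \<integral>\<omega>. norm (f n \<omega>) \<partial>M)"
      by (intro summable_comparison_test'[OF c_summable, of 0])
  qed
  moreover have "expectation (f n) =
      fps_hypergeo (map complex_of_real (\<sigma> # A)) (map complex_of_real B) 1 $ n * z ^ n" for n
  proof -
    have "(- 1) ^ n * (- z) ^ n = z ^ n" by (simp flip: power_mult_distrib)
    then have c: "c n = pochhammer (complex_of_real \<sigma>) n / fact n * z ^ n"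
      by (simp add: c_def gbinomial_pochhammer mult_ac)
    have "expectation (f n) = c n * complex_of_real (prod_list (map (\<lambda>a. pochhammer a n) A) /
        prod_list (map (\<lambda>b. pochhammer b n) B))"
      unfolding f_def integral_mult_right_zero integral_complex_of_real mom ..
    also note c
    finally have "expectation (f n) = pochhammer (complex_of_real \<sigma>) n / fact n * z ^ n *
        complex_of_real (prod_list (map (\<lambda>a. pochhammer a n) A) / prod_list (map (\<lambda>b. pochhammer b n) B))" .
    moreover have "complex_of_real (prod_list (map (\<lambda>a. pochhammer a n) A)) =
        prod_list (map (\<lambda>a. pochhammer (complex_of_real a) n) A)" for A
      by (induction A) (auto simp: pochhammer_of_real)
    ultimately show ?thesis by (simp add: foldl_mult_eq_prod_list o_def mult_ac)
  qed
  ultimately show "expectation (\<lambda>\<omega>. (1 - z * complex_of_real (X \<omega>)) powr (- complex_of_real \<sigma>)) =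
      eval_fps (fps_hypergeo (map complex_of_real (\<sigma> # A)) (map complex_of_real B) 1) z"
    using f_sums by (simp add: sums_iff eval_fps_def)
qed

section \<open>Jensen's inequality\<close>

text \<open>For fixed \<open>k\<close> and \<open>n\<close>, the k-th difference of
  \<open>- ln (y + m)\<close> is a function \<open>g\<close> of \<open>y\<close> whose derivative is
  computed by \<open>bdiff_inverse\<close>. It is negative and strictly increasing, because
  Pochhammer symbols increase with \<open>y\<close>, so the majorization inequality applies to
  \<open>g\<close>.\<close>

lemma sum_ln_bdiff_pos:
  fixes a b :: "nat \<Rightarrow> real"
  assumes a: "\<And>i. i < q \<Longrightarrow> 0 < a i" and b: "\<And>i. i < q \<Longrightarrow> 0 < b i"
    and b_mono: "\<And>i j. i \<le> j \<Longrightarrow> j < q \<Longrightarrow> b i \<le> b j"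
    and part: "\<And>k. k \<le> q \<Longrightarrow> (\<Sum>i<k. a i) \<le> (\<Sum>i<k. b i)"
    and ne: "\<exists>i<q. a i \<noteq> b i"
  shows "0 < bdiff k (\<lambda>n. \<Sum>i<q. ln (b i + real n) - ln (a i + real n)) n"
proof -
  define g where "g y = bdiff k (\<lambda>m. - ln (y + real m)) n" for y
  define g' where "g' y = - (fact k / pochhammer (y + real n) (Suc k))" for y :: real
  have "(\<Sum>i<q. g (b i)) < (\<Sum>i<q. g (a i))"
  proof (rule weak_majorization_sum_less[OF _ _ _ a b b_mono part ne])
    fix y :: real assume y: "0 < y"
    have "((\<lambda>y. bdiff k (\<lambda>m. - ln (y + real m)) n) has_real_derivative
        bdiff k (\<lambda>m. - 1 * (1 / (y + real m))) n) (at y)"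
      by (rule has_real_derivative_bdiff) (use y in \<open>auto intro!: derivative_eq_intros\<close>)
    then show "(g has_real_derivative g' y) (at y)"
      unfolding bdiff_cmult bdiff_inverse[OF y] g_def g'_def by simp
    show "g' y \<le> 0" using y by (auto simp: g'_def intro!: divide_nonneg_nonneg pochhammer_nonneg)
    fix z assume z: "y < z"
    have "pochhammer (y + real n) (Suc k) < pochhammer (z + real n) (Suc k)"
      unfolding pochhammer_prod using y z by (intro prod_mono_strict) auto
    moreover have "0 < pochhammer (y + real n) (Suc k)" using y by (intro pochhammer_pos) auto
    ultimately show "g' y < g' z" unfolding g'_def
      by (simp add: divide_strict_left_mono)
  qed
  moreover have "bdiff k (\<lambda>n. \<Sum>i<q. ln (b i + real n) - ln (a i + real n)) n =
      (\<Sum>i<q. g (a i)) - (\<Sum>i<q. g (b i))"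
    unfolding bdiff_sum bdiff_diff g_def
    using bdiff_cmult[of k "-1"] by (simp add: sum_negf sum_subtractf)
  ultimately show ?thesis by simp
qed

text \<open>The quotient \<open>m (Suc n) / m n\<close> is the product of the
  \<open>(a i + n) / (b i + n)\<close>, so the logarithmic differences are those of
  \<open>sum_ln_bdiff_pos\<close>.\<close>

lemma moment_ratio_bdiff:
  fixes a b :: "nat \<Rightarrow> real"
  assumes a: "\<And>i. i < q \<Longrightarrow> 0 < a i" and b: "\<And>i. i < q \<Longrightarrow> 0 < b i"
    and b_mono: "\<And>i j. i \<le> j \<Longrightarrow> j < q \<Longrightarrow> b i \<le> b j"
    and part: "\<And>k. k \<le> q \<Longrightarrow> (\<Sum>i<k. a i) \<le> (\<Sum>i<k. b i)"
    and ne: "\<exists>i<q. a i \<noteq> b i"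
  defines "m \<equiv> \<lambda>n. \<Prod>i<q. pochhammer (a i) n / pochhammer (b i) n"
  shows "0 \<le> bdiff k m n" and "(m 1)\<^sup>2 < m 2"
proof -
  have m_pos: "0 < m n" for n
    unfolding m_def using a b by (intro prod_pos) (auto intro!: divide_pos_pos pochhammer_pos)
  have ln_m: "(\<lambda>n. ln (m n) - ln (m (Suc n))) = (\<lambda>n. \<Sum>i<q. ln (b i + real n) - ln (a i + real n))"
  proof
    fix n
    have ab: "0 < a i + real n" "0 < b i + real n" if "i < q" for i
      using a b that by (auto intro!: add_pos_nonneg)
    have ab_nz: "a i + real n \<noteq> 0" "b i + real n \<noteq> 0" if "i < q" for i
      using ab[OF that] by simp_all
    have "ln (m (Suc n)) = ln (m n * (\<Prod>i<q. (a i + real n) / (b i + real n)))"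
      unfolding m_def by (simp add: pochhammer_Suc flip: prod.distrib)
    also have "\<dots> = ln (m n) + ln (\<Prod>i<q. (a i + real n) / (b i + real n))"
      using m_pos ab by (intro ln_mult_pos prod_pos) auto
    also have "ln (\<Prod>i<q. (a i + real n) / (b i + real n)) = (\<Sum>i<q. ln ((a i + real n) / (b i + real n)))"
      using ab_nz by (intro ln_prod) auto
    also have "\<dots> = (\<Sum>i<q. ln (a i + real n) - ln (b i + real n))"
    proof (rule sum.cong)
      fix i assume "i \<in> {..<q}"
      then show "ln ((a i + real n) / (b i + real n)) = ln (a i + real n) - ln (b i + real n)"
        using ab_nz[of i] by (simp add: ln_div)
    qed simp
    finally show "ln (m n) - ln (m (Suc n)) = (\<Sum>i<q. ln (b i + real n) - ln (a i + real n))"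
      by (simp add: sum_subtractf)
  qed
  have pos: "0 < bdiff k (\<lambda>n. ln (m n) - ln (m (Suc n))) n" for k n
    unfolding ln_m by (rule sum_ln_bdiff_pos[OF a b b_mono part ne])
  show "0 \<le> bdiff k m n"
    by (rule bdiff_nonneg_if_log[OF m_pos less_imp_le[OF pos]])
  \<comment> \<open>The case \<open>k = 1\<close>, \<open>n = 0\<close> is strict log-convexity at
    the start of the sequence.\<close>
  have "0 < ln (m 0) - 2 * ln (m 1) + ln (m 2)"
    using pos[of 1 0] by (simp add: numeral_2_eq_2)
  moreover have "m 0 = 1" by (simp add: m_def)
  ultimately have "ln ((m 1)\<^sup>2) < ln (m 2)" using m_pos[of 1] by (simp add: ln_realpow)
  then show "(m 1)\<^sup>2 < m 2" using m_pos[of 1] m_pos[of 2] by simp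
qed

text \<open>The gap \<open>h\<close> between the strictly convex power and its tangent at the mean
  is nonnegative and has expectation \<open>R - L\<close>. If that is 0 and
  \<open>x \<noteq> 0\<close>, then \<open>X\<close> is almost surely its mean, so its variance is
  0.\<close>

lemma (in prob_space) jensen_powr_neg:
  fixes X :: "'a \<Rightarrow> real" and \<sigma> x :: real
  assumes X: "X \<in> borel_measurable M" and X01: "\<And>\<omega>. X \<omega> \<in> {0..1}"
    and \<sigma>: "0 < \<sigma>" and x: "-1 < x"
  defines "L \<equiv> (1 + x * expectation X) powr - \<sigma>"
    and "R \<equiv> expectation (\<lambda>\<omega>. (1 + x * X \<omega>) powr - \<sigma>)"
  shows "L \<le> R" and "L = R \<Longrightarrow> x \<noteq> 0 \<Longrightarrow> expectation (\<lambda>\<omega>. X \<omega> ^ 2) = (expectation X)\<^sup>2"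
proof -
  have pos: "0 < 1 + x * t" if "t \<in> {0..1}" for t
  proof (cases "x < 0")
    case True
    then have "x * 1 \<le> x * t" using that by (intro mult_left_mono_neg) auto
    then show ?thesis using x by simp
  qed (use that in \<open>auto intro!: add_pos_nonneg\<close>)
  note int = integrable_continuous_on_compact[OF X, of "{0..1}"]
  have X_int: "integrable M X"
    by (rule int) (use X01 in auto)
  have R_int: "integrable M (\<lambda>\<omega>. (1 + x * X \<omega>) powr - \<sigma>)"
    by (rule int) (use X01 pos in \<open>force intro!: continuous_intros\<close>)+
  define \<mu> where "\<mu> = expectation X"
  have \<mu>01: "\<mu> \<in> {0..1}"
    using integral_le_const[OF X_int, of 1] X01 by (auto simp: \<mu>_def intro!: Bochner_Integration.integral_nonneg)
  define h where "h t = (1 + x * t) powr - \<sigma> -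
    ((1 + x * \<mu>) powr - \<sigma> - \<sigma> * (1 + x * \<mu>) powr (- \<sigma> - 1) * (x * (t - \<mu>)))" for t
  have h_pos: "0 < h t" if "t \<in> {0..1}" "x \<noteq> 0" "t \<noteq> \<mu>" for t
  proof -
    have "(1 + x * \<mu>) powr - \<sigma> + (- \<sigma> * (1 + x * \<mu>) powr (- \<sigma> - 1)) * (1 + x * t - (1 + x * \<mu>))
        < (1 + x * t) powr - \<sigma>"
    proof (rule tangent_below_strict)
      show "((\<lambda>y. y powr - \<sigma>) has_real_derivative - \<sigma> * y powr (- \<sigma> - 1)) (at y)" if "0 < y" for y
        using that by (auto intro!: derivative_eq_intros)
      show "- \<sigma> * y powr (- \<sigma> - 1) < - \<sigma> * z powr (- \<sigma> - 1)" if "0 < y" "y < z" for y z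
        using that \<sigma> by (simp add: powr_less_mono2_neg)
    qed (use pos that \<mu>01 in auto)
    then show ?thesis by (simp add: h_def algebra_simps)
  qed
  have h_nonneg: "0 \<le> h t" if "t \<in> {0..1}" for t
    using h_pos[OF that] by (cases "x = 0 \<or> t = \<mu>") (auto simp: h_def)
  have h_int: "integrable M (\<lambda>\<omega>. h (X \<omega>))"
    unfolding h_def using X_int R_int by auto
  \<comment> \<open>The linear term has expectation 0, since \<open>\<mu>\<close> is the mean of
    \<open>X\<close>.\<close>
  have Eh: "expectation (\<lambda>\<omega>. h (X \<omega>)) = R - L"
    unfolding h_def R_def L_def using X_int R_int by (simp add: prob_space \<mu>_def)
  have "0 \<le> expectation (\<lambda>\<omega>. h (X \<omega>))" using h_nonneg X01 by (intro Bochner_Integration.integral_nonneg) auto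
  then show "L \<le> R" using Eh by simp
  assume "L = R" "x \<noteq> 0"
  then have "AE \<omega> in M. h (X \<omega>) = 0"
    using integral_nonneg_eq_0_iff_AE[OF h_int] h_nonneg X01 Eh by auto
  then have "AE \<omega> in M. X \<omega> = \<mu>"
    by eventually_elim (use h_pos[OF X01 \<open>x \<noteq> 0\<close>] in force)
  then have "expectation (\<lambda>\<omega>. X \<omega> ^ 2) = expectation (\<lambda>_. \<mu>\<^sup>2)"
    using X by (intro integral_cong_AE) auto
  then show "expectation (\<lambda>\<omega>. X \<omega> ^ 2) = (expectation X)\<^sup>2" by (simp add: prob_space \<mu>_def)
qed

section \<open>From weak majorization to the inequality\<close>

lemma prod_list_eq_prod_nth: "prod_list (map f xs) = (\<Prod>i<length xs. f (xs ! i))"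
  using prod.list_conv_set_nth[of "map f xs"] by (simp add: atLeast0LessThan)

lemma sum_list_take_eq: "k \<le> length xs \<Longrightarrow> sum_list (take k xs) = (\<Sum>i<k. xs ! i)"
  by (simp add: sum_list_sum_nth atLeast0LessThan)

lemma weakly_majorized_hausdorff_moment:
  assumes "weakly_majorized B A"
  obtains M :: "real measure" and X :: "real \<Rightarrow> real"
  where "prob_space M" "X \<in> borel_measurable M" "\<And>s. X s \<in> {0..1}"
    "\<And>n. integral\<^sup>L M (\<lambda>s. X s ^ n) =
      prod_list (map (\<lambda>a. pochhammer a n) A) / prod_list (map (\<lambda>b. pochhammer b n) B)"
    "A \<noteq> B \<Longrightarrow> (integral\<^sup>L M X)\<^sup>2 < integral\<^sup>L M (\<lambda>s. X s ^ 2)"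
proof -
  define q where "q = length B"
  define m where "m n = (\<Prod>i<q. pochhammer (A ! i) n / pochhammer (B ! i) n)" for n
  have len: "length A = q" "length B = q" using assms by (auto simp: weakly_majorized_def q_def)
  have m_eq: "m n = prod_list (map (\<lambda>a. pochhammer a n) A) / prod_list (map (\<lambda>b. pochhammer b n) B)" for n
    by (simp add: m_def prod_list_eq_prod_nth len prod_dividef)
  have pos: "0 < A ! i" "0 < B ! i" if "i < q" for i
    using assms that len by (auto simp: weakly_majorized_def)
  have mono: "B ! i \<le> B ! j" if "i \<le> j" "j < q" for i j
    using assms that len by (auto simp: weakly_majorized_def sorted_nth_mono)
  have part: "(\<Sum>i<k. A ! i) \<le> (\<Sum>i<k. B ! i)" if "k \<le> q" for k
    using assms that len by (cases "k = 0") (auto simp: weakly_majorized_def simp flip: sum_list_take_eq)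
  note moment = moment_ratio_bdiff[of q "\<lambda>i. A ! i" "\<lambda>i. B ! i", OF pos mono part, folded m_def]
  have ne: "\<exists>i<q. A ! i \<noteq> B ! i" if "A \<noteq> B"
    using that len by (auto simp: list_eq_iff_nth_eq)
  have m0: "m 0 = 1" by (simp add: m_def)
  have cm: "0 \<le> bdiff k m n" for k n
  \<comment> \<open>For equal vectors \<open>m\<close> is constantly 1; the strict lemma covers only
    \<open>A \<noteq> B\<close>.\<close>
  proof (cases "A = B")
    case True
    have "pochhammer (B ! i) n \<noteq> 0" if "i < q" for i n
      using pochhammer_pos[OF pos(2)[OF that], of n] by simp
    then have "m = (\<lambda>n. 1)" by (auto simp: m_def True)
    moreover have "0 \<le> bdiff k (\<lambda>n. 1) n"
      by (rule bdiff_nonneg_if_log) (use bdiff_cmult[of _ 0 "\<lambda>n. 0"] in auto)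
    ultimately show ?thesis by simp
  next
    case False
    then show ?thesis by (intro moment(1) ne)
  qed
  obtain M :: "real measure" and X :: "real \<Rightarrow> real"
    where MX: "prob_space M" "X \<in> borel_measurable M" "\<And>s. X s \<in> {0..1}"
      "\<And>n. integral\<^sup>L M (\<lambda>s. X s ^ n) = m n"
    by (rule hausdorff_moment[OF m0 cm]) (rule that)
  have "(integral\<^sup>L M X)\<^sup>2 < integral\<^sup>L M (\<lambda>s. X s ^ 2)" if "A \<noteq> B"
    using moment(2) ne[OF that] MX(4)[of 1] MX(4)[of 2] by simp
  with MX show thesis by (intro that) (auto simp: m_eq)
qed

text \<open>For \<open>A = B\<close> both sides equal 1 / (1 + x)^\<sigma> for every
  \<open>x\<close>, hence the restriction of the equality clause to \<open>A \<noteq> B\<close>. As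
  \<open>hypergeo\<close> is complex-valued, \<open>F \<in> \<real>\<close> is asserted before
  \<open>Re F\<close> is compared.\<close>

theorem theorem5:
  fixes q :: nat and A B :: "real list" and \<sigma> x :: real
  assumes "q \<ge> 1" and "length A = q" and "length B = q"
    and "weakly_majorized B A"
    and "\<sigma> > 0"
    and "x > -1"
  defines "F \<equiv> hypergeo (map complex_of_real (\<sigma> # A)) (map complex_of_real B) (complex_of_real (- x))"
  defines "L \<equiv> 1 / (1 + x * (\<Prod>i<q. A ! i / B ! i)) powr \<sigma>"
  shows "F \<in> \<real> \<and> L \<le> Re F \<and> (A \<noteq> B \<longrightarrow> (L = Re F \<longleftrightarrow> x = 0))"
proof -
  obtain M :: "real measure" and X :: "real \<Rightarrow> real"
    where M: "prob_space M" and X: "X \<in> borel_measurable M" "\<And>s. X s \<in> {0..1}"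
      and mom: "\<And>n. integral\<^sup>L M (\<lambda>s. X s ^ n) =
        prod_list (map (\<lambda>a. pochhammer a n) A) / prod_list (map (\<lambda>b. pochhammer b n) B)"
      and var: "A \<noteq> B \<Longrightarrow> (integral\<^sup>L M X)\<^sup>2 < integral\<^sup>L M (\<lambda>s. X s ^ 2)"
    by (rule weakly_majorized_hausdorff_moment[OF assms(4)]) (rule that)
  interpret prob_space M by (rule M)
  have EX: "expectation X = (\<Prod>i<q. A ! i / B ! i)"
    using mom[of 1] assms(2,3) by (simp add: prod_list_eq_prod_nth[of "\<lambda>a. a", simplified] prod_dividef)
  define R where "R = expectation (\<lambda>\<omega>. (1 + x * X \<omega>) powr - \<sigma>)"
  have pos: "0 \<le> 1 + x * X \<omega>" for \<omega>
  proof -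
    have "- X \<omega> \<le> x * X \<omega>" using X(2)[of \<omega>] mult_right_mono[of "-1" x "X \<omega>"] assms(6) by simp
    then show ?thesis using X(2)[of \<omega>] by simp
  qed
  have notin: "complex_of_real (- x) \<notin> complex_of_real ` {1..}"
    using assms(6) unfolding image_iff of_real_eq_iff by auto
  have eq: "1 - complex_of_real (- x) * complex_of_real (X \<omega>) = complex_of_real (1 + x * X \<omega>)" for \<omega>
    by simp
  \<comment> \<open>Since \<open>- x < 1\<close> lies off the cut, uniqueness of the continuation
    gives this also for \<open>x \<ge> 1\<close>, outside the disc of convergence.\<close>
  have "F = expectation (\<lambda>\<omega>. (1 - complex_of_real (- x) * complex_of_real (X \<omega>)) powr - complex_of_real \<sigma>)"
    unfolding F_def by (rule hypergeo_unique[OF is_hypergeo_expectation[OF X mom] notin])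
  also have "\<dots> = expectation (\<lambda>\<omega>. complex_of_real ((1 + x * X \<omega>) powr - \<sigma>))"
    unfolding eq of_real_minus[symmetric] powr_of_real[OF pos] ..
  also have "\<dots> = complex_of_real R" by (simp add: R_def)
  finally have F: "F = complex_of_real R" .
  have L: "L = (1 + x * expectation X) powr - \<sigma>"
    unfolding L_def EX by (simp add: powr_minus_divide)
  have "L = R" if "x = 0" using that by (simp add: L R_def prob_space)
  \<comment> \<open>Equality with \<open>x \<noteq> 0\<close> would force variance 0, against the
    strict second-moment inequality \<open>var\<close>.\<close>
  moreover have "x = 0" if "L = R" "A \<noteq> B"
    using jensen_powr_neg(2)[OF X assms(5,6), folded R_def L] that(1) var[OF that(2)] by linarith
  moreover have "L \<le> R"
    using jensen_powr_neg(1)[OF X assms(5,6)] unfolding L R_def .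
  ultimately show ?thesis unfolding F by auto
qed

end
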